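(* Let $\mathbf{K}=\bigcup_n\mathbf{A}_n$ be a Fraïssé structure with a fixed exhaustion, and suppose each $\mathbf{A}_m$ has finite big Ramsey degree $R_m<\omega$. Assume that for each $m<\omega$ there is an unavoidable $R_m$-coloring $\gamma_m$ of $H_m$ such that $\gamma_m\ll\gamma_n$ for all $m\le n<\omega$. Then $\mathbf{K}$ admits a big Ramsey structure.
   Context: All languages are relational. A countable structure $\mathbf{K}$ is Fraïssé if every embedding of a finite substructure of $\mathbf{K}$ into $\mathbf{K}$ extends to an automorphism. An exhaustion is a sequence of finite substructures $\emptyset=\mathbf{A}_0\subseteq\mathbf{A}_1\subseteq\cdots$ with union $\mathbf{K}$. $H_m=\mathrm{Emb}(\mathbf{A}_m,\mathbf{K})$, $H_m^n=\mathrm{Emb}(\mathbf{A}_m,\mathbf{A}_n)$ for $m\le n$; $\widehat G=\mathrm{Emb}(\mathbf{K},\mathbf{K})$. Big Ramsey degree: for finite $\mathbf{A}$ embeddable in $\mathbf{K}$ and $r,\ell<\omega$, $\mathbf{K}\to(\mathbf{K})^{\mathbf{A}}_{r,\ell}$ means every $\gamma:\mathrm{Emb}(\mathbf{A},\mathbf{K})\to r$ admits $\eta\in\mathrm{Emb}(\mathbf{K})$ with $|\{\gamma(\eta\circ f):f\in\mathrm{Emb}(\mathbf{A},\mathbf{K})\}|\le\ell$; the big Ramsey degree of $\mathbf{A}$ is the least $\ell$ such that this holds for every $r>\ell$. A set $S\subseteq H_m$ is unavoidable if for every $\eta\in\widehat G$ the set $\eta^{-1}(S)=\{f\in H_m:\eta\circ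 f\in S\}$ is nonempty. For $k\le r<\omega$, a map $\gamma:H_m\to r$ is an unavoidable $k$-coloring if $|\mathrm{im}(\gamma)|=k$ and every fiber $\gamma^{-1}(\{i\})$ is either empty or unavoidable. For colorings $\gamma$ of $H_m$ and $\delta$ of $H_n$ ($m\le n$), $\gamma\ll\delta$ means: for every $f\in H_m^n$ and $s_0,s_1\in H_n$, $\delta(s_0)=\delta(s_1)$ implies $\gamma(s_0\circ f)=\gamma(s_1\circ f)$. For a set $A$, an $L$-structure $\mathbf{B}$ and an injection $f:A\to B$, $\mathbf{B}\cdot f$ is the unique structure on $A$ making $f$ an embedding into $\mathbf{B}$. A big Ramsey structure for the $L$-structure $\mathbf{K}$ is an $L'$-structure $\mathbf{K}'$ ($L'\supseteq L$) with: $\mathbf{K}'|_L=\mathbf{K}$; every finite $\mathbf{A}\in\mathrm{Age}(\mathbf{K})$ has finitely many expansions in $\mathrm{Age}(\mathbf{K}')$ (set $\mathbf{K}'(\mathbf{A})$); $\mathbf{A}$ has big Ramsey degree $|\mathbf{K}'(\mathbf{A})|$; and for every $\eta\in\mathrm{Emb}(\mathbf{K})$, $\{\mathbf{K}'\cdot(\eta\circ f):f\in\mathrm{Emb}(\mathbf{A},\mathbf{K})\}=\mathbf{K}'(\mathbf{A})$. *)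

theory Defs
  imports Main "HOL-Library.FuncSet" "HOL-Library.Countable_Set"
begin

text \<open>
  A relational language is a partial map from symbols to arities; its domain is the set of
  symbols of the language.
\<close>

type_synonym 's language = "'s \<rightharpoonup> nat"

record ('s, 'a) struct =
  universe :: "'a set"
  interp :: "'s \<Rightarrow> 'a list set"

text \<open>
  Symbols outside the language are interpreted by the empty set, so that equality of
  \<open>L\<close>-structures is HOL equality.
\<close>

definition is_structure :: "'s language \<Rightarrow> ('s, 'a) struct \<Rightarrow> bool" where
  "is_structure L A \<longleftrightarrow>
     (\<forall>s. \<forall>xs \<in> interp A s. set xs \<subseteq> universe A \<and> L s = Some (length xs))"

definition substructure :: "('s, 'a) struct \<Rightarrow> ('s, 'a) struct \<Rightarrow> bool" where
  "substructure A B \<longleftrightarrow>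
     universe A \<subseteq> universe B \<and>
     (\<forall>s. interp A s = {xs \<in> interp B s. set xs \<subseteq> universe A})"

text \<open>
  Embeddings are extensional functions, so that \<open>emb A B\<close> is in bijection with the set of
  embeddings of \<open>A\<close> into \<open>B\<close>. Accordingly, the composite of \<open>g\<close> with \<open>f \<in> emb A B\<close> is
  \<open>compose (universe A) g f\<close>.
\<close>

definition emb :: "('s, 'a) struct \<Rightarrow> ('s, 'b) struct \<Rightarrow> ('a \<Rightarrow> 'b) set" where
  "emb A B = {f \<in> universe A \<rightarrow>\<^sub>E universe B. inj_on f (universe A) \<and>
     (\<forall>s xs. set xs \<subseteq> universe A \<longrightarrow> (xs \<in> interp A s \<longleftrightarrow> map f xs \<in> interp B s))}"

definition aut :: "('s, 'a) struct \<Rightarrow> ('a \<Rightarrow> 'a) set" where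
  "aut K = {g \<in> emb K K. g ` universe K = universe K}"

definition fraisse :: "'s language \<Rightarrow> ('s, 'a) struct \<Rightarrow> bool" where
  "fraisse L K \<longleftrightarrow>
     is_structure L K \<and> countable (universe K) \<and>
     (\<forall>A. substructure A K \<and> finite (universe A) \<longrightarrow>
        (\<forall>f \<in> emb A K. \<exists>g \<in> aut K. \<forall>x \<in> universe A. g x = f x))"

definition exhaustion :: "('s, 'a) struct \<Rightarrow> (nat \<Rightarrow> ('s, 'a) struct) \<Rightarrow> bool" where
  "exhaustion K A \<longleftrightarrow>
     universe (A 0) = {} \<and>
     (\<forall>n. finite (universe (A n)) \<and> substructure (A n) K \<and> substructure (A n) (A (Suc n))) \<and>
     (\<Union>n. universe (A n)) = universe K"

text \<open>The partition relation \<open>K \<rightarrow> (K)\<^sup>A\<^sub>r\<^sub>,\<^sub>l\<close>.\<close>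

definition big_ramsey_arrow :: "('s, 'a) struct \<Rightarrow> ('s, 'b) struct \<Rightarrow> nat \<Rightarrow> nat \<Rightarrow> bool" where
  "big_ramsey_arrow K A r l \<longleftrightarrow>
     (\<forall>\<gamma> \<in> emb A K \<rightarrow> {..<r}. \<exists>\<eta> \<in> emb K K.
        card ((\<lambda>f. \<gamma> (compose (universe A) \<eta> f)) ` emb A K) \<le> l)"

definition has_big_ramsey_degree :: "('s, 'a) struct \<Rightarrow> ('s, 'b) struct \<Rightarrow> nat \<Rightarrow> bool" where
  "has_big_ramsey_degree K A l \<longleftrightarrow>
     (\<forall>r>l. big_ramsey_arrow K A r l) \<and>
     (\<forall>l'. (\<forall>r>l'. big_ramsey_arrow K A r l') \<longrightarrow> l \<le> l')"

definition unavoidable ::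
  "('s, 'a) struct \<Rightarrow> ('s, 'b) struct \<Rightarrow> ('b \<Rightarrow> 'a) set \<Rightarrow> bool" where
  "unavoidable K A S \<longleftrightarrow>
     S \<subseteq> emb A K \<and>
     (\<forall>\<eta> \<in> emb K K. {f \<in> emb A K. compose (universe A) \<eta> f \<in> S} \<noteq> {})"

definition unavoidable_coloring ::
  "('s, 'a) struct \<Rightarrow> ('s, 'b) struct \<Rightarrow> nat \<Rightarrow> (('b \<Rightarrow> 'a) \<Rightarrow> nat) \<Rightarrow> bool" where
  "unavoidable_coloring K A k \<gamma> \<longleftrightarrow>
     (\<exists>r\<ge>k. \<gamma> \<in> emb A K \<rightarrow> {..<r} \<and>
        card (\<gamma> ` emb A K) = k \<and>
        (\<forall>i<r. {f \<in> emb A K. \<gamma> f = i} = {} \<or> unavoidable K A {f \<in> emb A K. \<gamma> f = i}))"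

text \<open>The relation \<open>\<gamma> \<lless> \<delta>\<close> for colorings \<open>\<gamma>\<close> of \<open>emb A K\<close> and \<open>\<delta>\<close> of \<open>emb B K\<close>.\<close>

definition coloring_ll ::
  "('s, 'a) struct \<Rightarrow> ('s, 'b) struct \<Rightarrow> ('s, 'c) struct \<Rightarrow>
   (('b \<Rightarrow> 'a) \<Rightarrow> 'i) \<Rightarrow> (('c \<Rightarrow> 'a) \<Rightarrow> 'j) \<Rightarrow> bool" where
  "coloring_ll K A B \<gamma> \<delta> \<longleftrightarrow>
     (\<forall>f \<in> emb A B. \<forall>s\<^sub>0 \<in> emb B K. \<forall>s\<^sub>1 \<in> emb B K. \<delta> s\<^sub>0 = \<delta> s\<^sub>1 \<longrightarrow>
        \<gamma> (compose (universe A) s\<^sub>0 f) = \<gamma> (compose (universe A) s\<^sub>1 f))"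

text \<open>
  \<open>pullback B S f\<close> is the structure \<open>B \<cdot> f\<close> for an injection \<open>f\<close> of the set \<open>S\<close> into the
  universe of \<open>B\<close>.
\<close>

definition pullback :: "('s, 'b) struct \<Rightarrow> 'a set \<Rightarrow> ('a \<Rightarrow> 'b) \<Rightarrow> ('s, 'a) struct" where
  "pullback B S f =
     \<lparr>universe = S, interp = (\<lambda>s. {xs. set xs \<subseteq> S \<and> map f xs \<in> interp B s})\<rparr>"

lemma pullback_unique:
  assumes "is_structure L B" "f \<in> S \<rightarrow>\<^sub>E universe B" "inj_on f S"
  shows "is_structure L C \<and> universe C = S \<and> f \<in> emb C B \<longleftrightarrow> C = pullback B S f"
proof
  assume "is_structure L C \<and> universe C = S \<and> f \<in> emb C B"
  then have C: "is_structure L C" "universe C = S" "f \<in> emb C B" by auto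
  have "xs \<in> interp C s \<longleftrightarrow> xs \<in> interp (pullback B S f) s" for s xs
  proof (cases "set xs \<subseteq> S")
    case True
    with C show ?thesis by (simp add: emb_def pullback_def)
  next
    case False
    with C show ?thesis by (auto simp: is_structure_def pullback_def)
  qed
  then show "C = pullback B S f"
    using C by (intro struct.equality) (auto simp: pullback_def)
next
  assume "C = pullback B S f"
  with assms show "is_structure L C \<and> universe C = S \<and> f \<in> emb C B"
    by (auto simp: is_structure_def emb_def pullback_def)
qed

text \<open>
  The age consists of all finite embeddable \<open>L\<close>-structures carried by subsets of the type \<open>'a\<close>
  of the points of \<open>K\<close>. Every finite structure embeddable in \<open>K\<close> is isomorphic to one of these.
\<close>

definition age :: "'s language \<Rightarrow> ('s, 'a) struct \<Rightarrow> ('s, 'a) struct set" where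
  "age L K = {A. is_structure L A \<and> finite (universe A) \<and> emb A K \<noteq> {}}"

text \<open>
  The symbols of an expanded language are taken from \<open>'s + 't\<close>, where \<open>'s\<close> is the type of the
  symbols of \<open>L\<close> and a symbol \<open>s\<close> of \<open>L\<close> is identified with \<open>Inl s\<close>.
\<close>

definition sublanguage :: "'s language \<Rightarrow> ('s + 't) language \<Rightarrow> bool" where
  "sublanguage L L' \<longleftrightarrow> (\<forall>s \<in> dom L. L' (Inl s) = L s)"

definition reduct :: "'s language \<Rightarrow> ('s + 't, 'a) struct \<Rightarrow> ('s, 'a) struct" where
  "reduct L B =
     \<lparr>universe = universe B, interp = (\<lambda>s. if s \<in> dom L then interp B (Inl s) else {})\<rparr>"

text \<open>The set \<open>K'(A)\<close> of expansions of \<open>A\<close> in the age of \<open>K'\<close>.\<close>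

definition expansions ::
  "'s language \<Rightarrow> ('s + 't) language \<Rightarrow> ('s + 't, 'a) struct \<Rightarrow> ('s, 'a) struct \<Rightarrow>
   ('s + 't, 'a) struct set" where
  "expansions L L' K' A = {B \<in> age L' K'. reduct L B = A}"

definition big_ramsey_structure ::
  "'s language \<Rightarrow> ('s, 'a) struct \<Rightarrow> ('s + 't) language \<Rightarrow> ('s + 't, 'a) struct \<Rightarrow> bool" where
  "big_ramsey_structure L K L' K' \<longleftrightarrow>
     sublanguage L L' \<and> is_structure L' K' \<and> reduct L K' = K \<and>
     (\<forall>A \<in> age L K.
        finite (expansions L L' K' A) \<and>
        has_big_ramsey_degree K A (card (expansions L L' K' A)) \<and>
        (\<forall>\<eta> \<in> emb K K.
           (\<lambda>f. pullback K' (universe A) (compose (universe A) \<eta> f)) ` emb A K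
             = expansions L L' K' A))"

end

theory Submission
  imports Defs
begin

text \<open>
  Call tuples \<open>h zs\<close> and \<open>h' zs\<close> of points of \<open>K\<close> adjacent if \<open>zs\<close> lies in some \<open>A n\<close> and
  \<open>h, h' \<in> emb (A n) K\<close> have the same \<open>\<gamma> n\<close>-colour. The expansion names the connected components
  of this graph. It has to be defined on all tuples: a relation for each colour of \<open>emb (A n) K\<close>
  would say nothing about those \<open>B\<close> in the age that are not isomorphic to any \<open>A n\<close>.

  Fix \<open>b \<in> emb B (A n)\<close> and call a colouring of \<open>emb B K\<close> measurable if its value at \<open>h \<circ> b\<close>
  depends only on \<open>\<gamma> n h\<close>. Since \<open>\<gamma> n\<close> attains the degree \<open>R n\<close>, every finite colouring agrees
  with a measurable one on \<open>\<eta> \<circ> emb B K\<close> for some \<open>\<eta>\<close>. Two measurable colourings that agree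
  there are equal, even if they are measurable for different \<open>n\<close> and \<open>b\<close>. Hence measurability does
  not depend on \<open>n\<close> and \<open>b\<close>, and the measurable colourings are precisely those that factor through
  the expansion.
\<close>

section \<open>Embeddings, factorisation and homogeneity\<close>

lemma embI:
  assumes "f \<in> universe A \<rightarrow>\<^sub>E universe B" "inj_on f (universe A)"
    and "\<And>s xs. set xs \<subseteq> universe A \<Longrightarrow> xs \<in> interp A s \<longleftrightarrow> map f xs \<in> interp B s"
  shows "f \<in> emb A B"
  using assms by (auto simp: emb_def)

lemma emb_mem: "f \<in> emb A B \<Longrightarrow> x \<in> universe A \<Longrightarrow> f x \<in> universe B"
  by (auto simp: emb_def)

lemma emb_inj: "f \<in> emb A B \<Longrightarrow> inj_on f (universe A)"
  by (auto simp: emb_def)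

lemma emb_interp:
  "f \<in> emb A B \<Longrightarrow> set xs \<subseteq> universe A \<Longrightarrow> xs \<in> interp A s \<longleftrightarrow> map f xs \<in> interp B s"
  by (auto simp: emb_def)

lemma emb_map_lists: "f \<in> emb A B \<Longrightarrow> set xs \<subseteq> universe A \<Longrightarrow> map f xs \<in> lists (universe B)"
  by (induction xs) (auto simp: emb_mem)

lemma emb_ext: "f \<in> emb A B \<Longrightarrow> f \<in> extensional (universe A)"
  by (auto simp: emb_def PiE_def)

lemma emb_eqI:
  assumes "f \<in> emb A B" "g \<in> emb A C" "\<And>x. x \<in> universe A \<Longrightarrow> f x = g x"
  shows "f = g"
  using assms by (meson emb_ext extensionalityI)

lemma emb_compose:
  assumes f: "f \<in> emb A B" and g: "g \<in> emb B C"
  shows "compose (universe A) g f \<in> emb A C"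
proof (rule embI)
  show "compose (universe A) g f \<in> universe A \<rightarrow>\<^sub>E universe C"
    using f g by (auto simp: compose_def emb_mem)
  show "inj_on (compose (universe A) g f) (universe A)"
    using emb_inj[OF f] emb_inj[OF g] emb_mem[OF f]
    by (auto simp: inj_on_def compose_def)
  fix s xs assume xs: "set xs \<subseteq> universe A"
  then have "map (compose (universe A) g f) xs = map g (map f xs)"
    by (auto simp: compose_def)
  moreover have "set (map f xs) \<subseteq> universe B"
    using xs emb_mem[OF f] by auto
  ultimately show "xs \<in> interp A s \<longleftrightarrow> map (compose (universe A) g f) xs \<in> interp C s"
    using emb_interp[OF f xs] emb_interp[OF g] by metis
qed

lemma emb_compose_assoc:
  assumes "f \<in> emb A B"
  shows "compose (universe A) (compose (universe B) h g) f
    = compose (universe A) h (compose (universe A) g f)"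
  using emb_mem[OF assms] by (auto simp: compose_def)

lemma emb_restrict:
  assumes "substructure A B" "f \<in> emb B C"
  shows "restrict f (universe A) \<in> emb A C"
proof (rule embI)
  have sub: "universe A \<subseteq> universe B"
    using assms by (auto simp: substructure_def)
  show "restrict f (universe A) \<in> universe A \<rightarrow>\<^sub>E universe C"
    using sub emb_mem[OF assms(2)] by auto
  show "inj_on (restrict f (universe A)) (universe A)"
    using emb_inj[OF assms(2)] sub by (simp add: inj_on_subset)
  fix s xs assume xs: "set xs \<subseteq> universe A"
  then have "map (restrict f (universe A)) xs = map f xs"
    by auto
  moreover have "xs \<in> interp A s \<longleftrightarrow> xs \<in> interp B s"
    using assms(1) xs by (auto simp: substructure_def)
  ultimately show "xs \<in> interp A s \<longleftrightarrow> map (restrict f (universe A)) xs \<in> interp C s"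
    using emb_interp[OF assms(2), of xs s] xs sub by (simp only: subset_trans)
qed

lemma emb_id: "restrict (\<lambda>x. x) (universe A) \<in> emb A A"
proof (rule embI)
  fix s xs assume "set xs \<subseteq> universe A"
  then have "map (restrict (\<lambda>x. x) (universe A)) xs = xs"
    by (intro map_idI) auto
  then show "xs \<in> interp A s \<longleftrightarrow> map (restrict (\<lambda>x. x) (universe A)) xs \<in> interp A s"
    by simp
qed (auto simp: inj_on_def)

lemma emb_into_substructure:
  assumes "substructure B C" "f \<in> emb A C" "f ` universe A \<subseteq> universe B"
  shows "f \<in> emb A B"
proof (rule embI)
  show "f \<in> universe A \<rightarrow>\<^sub>E universe B"
    using assms(3) emb_ext[OF assms(2)] by (auto simp: PiE_def)
  show "inj_on f (universe A)"
    by (rule emb_inj[OF assms(2)])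
  fix s xs assume xs: "set xs \<subseteq> universe A"
  then have "set (map f xs) \<subseteq> universe B"
    using assms(3) by auto
  then show "xs \<in> interp A s \<longleftrightarrow> map f xs \<in> interp B s"
    using emb_interp[OF assms(2) xs] assms(1) by (auto simp: substructure_def)
qed

lemma emb_of_substructure: "substructure A B \<Longrightarrow> restrict (\<lambda>x. x) (universe A) \<in> emb A B"
  using emb_restrict[OF _ emb_id, of A B]
  by (simp add: substructure_def restrict_restrict Int_absorb1)

lemma emb_out_of_substructure:
  assumes "substructure B C" "f \<in> emb A B"
  shows "f \<in> emb A C"
proof -
  have *: "compose (universe A) (restrict (\<lambda>x. x) (universe B)) f \<in> emb A C"
    using emb_compose[OF assms(2) emb_of_substructure[OF assms(1)]] .
  have "compose (universe A) (restrict (\<lambda>x. x) (universe B)) f = f"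
    by (rule emb_eqI[OF * assms(2)]) (simp add: compose_def emb_mem[OF assms(2)])
  with * show ?thesis by simp
qed

text \<open>Since \<open>g\<close> reflects relations as well as preserving them, its inverse on the
  image composed with \<open>f\<close> is again an embedding.\<close>

lemma emb_factor:
  assumes f: "f \<in> emb A C" and g: "g \<in> emb B C" and sub: "f ` universe A \<subseteq> g ` universe B"
  obtains b where "b \<in> emb A B" "compose (universe A) g b = f"
proof
  let ?b = "restrict (inv_into (universe B) g \<circ> f) (universe A)"
  have gb: "g (?b x) = f x" and b: "?b x \<in> universe B" if "x \<in> universe A" for x
    using that sub by (auto simp: f_inv_into_f image_subset_iff inv_into_into)
  show b_emb: "?b \<in> emb A B"
  proof (rule embI)
    show "?b \<in> universe A \<rightarrow>\<^sub>E universe B"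
      using b by auto
    show "inj_on ?b (universe A)"
      using gb emb_inj[OF f] by (metis inj_on_def)
    fix s xs assume xs: "set xs \<subseteq> universe A"
    then have "map g (map ?b xs) = map f xs"
      using gb by (simp add: subset_iff)
    moreover have "set (map ?b xs) \<subseteq> universe B"
      using xs b by auto
    ultimately show "xs \<in> interp A s \<longleftrightarrow> map ?b xs \<in> interp B s"
      using emb_interp[OF f xs] emb_interp[OF g] by metis
  qed
  show "compose (universe A) g ?b = f"
    by (rule emb_eqI[OF emb_compose[OF b_emb g] f]) (simp only: compose_eq gb)
qed

lemma fraisse_extend:
  assumes K: "fraisse L K" and A: "finite (universe A)" and B: "substructure B K"
    and b: "b \<in> emb A B" and f: "f \<in> emb A K"
  obtains h where "h \<in> emb B K" "compose (universe A) h b = f"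
proof -
  define C :: "('a, 'b) struct" where
    "C = \<lparr>universe = b ` universe A, interp = (\<lambda>s. {xs \<in> interp K s. set xs \<subseteq> b ` universe A})\<rparr>"
  have bK: "b \<in> emb A K"
    using emb_out_of_substructure[OF B b] .
  have C: "substructure C K" "universe C = b ` universe A"
    using emb_mem[OF bK] by (auto simp: C_def substructure_def)
  have bC: "b \<in> emb A C"
    using emb_into_substructure[OF C(1) bK] C(2) by simp
  \<comment> \<open>Factoring the identity of \<open>C\<close> through \<open>b\<close> produces the
    inverse \<open>c\<close> of \<open>b\<close>.\<close>
  have "restrict (\<lambda>x. x) (universe C) \<in> emb C C" by (rule emb_id)
  then obtain c where c: "c \<in> emb C A" "compose (universe C) b c = restrict (\<lambda>x. x) (universe C)"
    using emb_factor[OF _ bC] C(2) by force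
  have "compose (universe C) f c \<in> emb C K"
    using emb_compose[OF c(1) f] .
  moreover have "finite (universe C)"
    using A C(2) by simp
  ultimately obtain g where g: "g \<in> aut K" "\<forall>x \<in> universe C. g x = compose (universe C) f c x"
    using K C(1) unfolding fraisse_def by blast
  have cb: "c (b x) = x" if x: "x \<in> universe A" for x
  proof (rule inj_onD[OF emb_inj[OF b]])
    have bx: "b x \<in> universe C" using x C(2) by auto
    then show "b (c (b x)) = b x"
      using c(2) by (metis compose_eq restrict_apply')
    show "c (b x) \<in> universe A" using emb_mem[OF c(1) bx] .
  qed (fact x)
  have *: "g (b x) = f x" if x: "x \<in> universe A" for x
  proof -
    have "b x \<in> universe C" using x C(2) by auto
    with g(2) x show ?thesis by (simp add: compose_def cb)
  qed
  have gK: "g \<in> emb K K" using g(1) by (simp add: aut_def)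
  show thesis
  proof
    show h: "restrict g (universe B) \<in> emb B K"
      using emb_restrict[OF B gK] .
    show "compose (universe A) (restrict g (universe B)) b = f"
      by (rule emb_eqI[OF emb_compose[OF b h] f]) (simp add: compose_def emb_mem[OF b] *)
  qed
qed

section \<open>Finite colourings and exhaustions\<close>

lemma big_ramsey_degree_finite_coloring:
  assumes "has_big_ramsey_degree K A l" "finite (\<chi> ` emb A K)"
  obtains \<eta> where "\<eta> \<in> emb K K"
    "card ((\<lambda>f. \<chi> (compose (universe A) \<eta> f)) ` emb A K) \<le> l"
proof -
  obtain e where e: "bij_betw e (\<chi> ` emb A K) {0..<card (\<chi> ` emb A K)}"
    using ex_bij_betw_finite_nat[OF assms(2)] by blast
  \<comment> \<open>The summand \<open>l + 1\<close> makes the number of available colours exceed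
    \<open>l\<close>, as the degree requires.\<close>
  have "e \<circ> \<chi> \<in> emb A K \<rightarrow> {..<card (\<chi> ` emb A K) + l + 1}"
  proof
    fix f assume "f \<in> emb A K"
    then have "e (\<chi> f) \<in> {0..<card (\<chi> ` emb A K)}"
      using bij_betwE[OF e] by auto
    then show "(e \<circ> \<chi>) f \<in> {..<card (\<chi> ` emb A K) + l + 1}" by auto
  qed
  moreover have "big_ramsey_arrow K A (card (\<chi> ` emb A K) + l + 1) l"
    using assms(1) by (simp add: has_big_ramsey_degree_def)
  ultimately obtain \<eta> where \<eta>: "\<eta> \<in> emb K K"
    "card ((\<lambda>f. (e \<circ> \<chi>) (compose (universe A) \<eta> f)) ` emb A K) \<le> l"
    unfolding big_ramsey_arrow_def by blast
  have "(\<lambda>f. (e \<circ> \<chi>) (compose (universe A) \<eta> f)) ` emb A K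
      = e ` (\<lambda>f. \<chi> (compose (universe A) \<eta> f)) ` emb A K"
    by (auto simp: image_image)
  moreover have "inj_on e ((\<lambda>f. \<chi> (compose (universe A) \<eta> f)) ` emb A K)"
    by (rule inj_on_subset[OF bij_betw_imp_inj_on[OF e]]) (auto intro: emb_compose \<eta>(1))
  ultimately have "card ((\<lambda>f. \<chi> (compose (universe A) \<eta> f)) ` emb A K) \<le> l"
    using \<eta>(2) by (simp add: card_image)
  with \<eta>(1) show thesis by (rule that)
qed

lemma unavoidable_coloring_attained:
  assumes \<gamma>: "unavoidable_coloring K A k \<gamma>" and f: "f \<in> emb A K" and \<eta>: "\<eta> \<in> emb K K"
  obtains g where "g \<in> emb A K" "\<gamma> (compose (universe A) \<eta> g) = \<gamma> f"
proof -
  obtain r where r: "\<gamma> \<in> emb A K \<rightarrow> {..<r}"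
    "\<forall>i<r. {f \<in> emb A K. \<gamma> f = i} = {} \<or> unavoidable K A {f \<in> emb A K. \<gamma> f = i}"
    using \<gamma> by (auto simp: unavoidable_coloring_def)
  have "\<gamma> f < r" using r(1) f by auto
  with r(2) f have "unavoidable K A {g \<in> emb A K. \<gamma> g = \<gamma> f}" by blast
  with \<eta> that show thesis unfolding unavoidable_def by blast
qed

lemma finite_unavoidable_coloring:
  "unavoidable_coloring K A k \<gamma> \<Longrightarrow> finite (\<gamma> ` emb A K)"
  by (auto simp: unavoidable_coloring_def intro: finite_subset[of _ "{..<_}"])

lemma exhaustion_mono:
  assumes "exhaustion K A" "m \<le> n"
  shows "universe (A m) \<subseteq> universe (A n)"
  using assms(2)
  by (rule lift_Suc_mono_le[of "\<lambda>n. universe (A n)", rotated])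
    (use assms(1) in \<open>auto simp: exhaustion_def substructure_def\<close>)

lemma exhaustion_finite_subset:
  assumes "exhaustion K A" "finite S" "S \<subseteq> universe K"
  obtains n where "m \<le> n" "S \<subseteq> universe (A n)"
proof -
  have "\<exists>n\<ge>m. S \<subseteq> universe (A n)"
    using assms(2,3)
  proof (induction S rule: finite_induct)
    case (insert x S)
    then obtain n where n: "n \<ge> m" "S \<subseteq> universe (A n)" by auto
    obtain k where k: "x \<in> universe (A k)"
      using insert.prems assms(1) unfolding exhaustion_def by blast
    show ?case
      by (rule exI[of _ "max n k"])
        (use n k exhaustion_mono[OF assms(1), of n "max n k"]
          exhaustion_mono[OF assms(1), of k "max n k"] in auto)
  qed auto
  then show thesis using that by blast
qed

section \<open>Correcting the colours changed by a self-embedding\<close>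

locale coherent_colorings =
  fixes L :: "'s language"
    and K :: "('s, 'a) struct"
    and A :: "nat \<Rightarrow> ('s, 'a) struct"
    and R :: "nat \<Rightarrow> nat"
    and \<gamma> :: "nat \<Rightarrow> ('a \<Rightarrow> 'a) \<Rightarrow> nat"
  assumes fraisse: "fraisse L K"
    and exhaustion: "exhaustion K A"
    and degree: "has_big_ramsey_degree K (A m) (R m)"
    and coloring: "unavoidable_coloring K (A m) (R m) (\<gamma> m)"
    and coherent: "m \<le> n \<Longrightarrow> coloring_ll K (A m) (A n) (\<gamma> m) (\<gamma> n)"
begin

lemma sub: "substructure (A n) K"
  and finite_level: "finite (universe (A n))"
  using exhaustion by (auto simp: exhaustion_def)

lemma emb_level_finite: "b \<in> emb B (A n) \<Longrightarrow> finite (universe B)"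
  using finite_level[of n] emb_inj[of b B "A n"] emb_mem[of b B "A n"]
  by (meson finite_imageD finite_subset image_subsetI)

lemma emb_factor_level:
  assumes "f \<in> emb B K" "finite (universe B)"
  obtains n where "f \<in> emb B (A n)"
proof -
  have "f ` universe B \<subseteq> universe K"
    using emb_mem[OF assms(1)] by auto
  then obtain n where "f ` universe B \<subseteq> universe (A n)"
    using exhaustion_finite_subset[OF exhaustion, of "f ` universe B" 0] assms(2) by blast
  then show thesis
    using that emb_into_substructure[OF sub assms(1)] by blast
qed

lemma emb_extend_level:
  assumes "b \<in> emb B (A n)" "f \<in> emb B K"
  obtains h where "h \<in> emb (A n) K" "compose (universe B) h b = f"
  using fraisse_extend[OF fraisse emb_level_finite[OF assms(1)] sub assms] by blast

text \<open>Applying \<eta> may change colours; precomposing with \<open>s\<close> undoes this for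
  all embeddings into \<open>A N\<close>, simultaneously for all levels
  \<open>m \<le> N\<close>.\<close>

definition corrects :: "('a \<Rightarrow> 'a) \<Rightarrow> nat \<Rightarrow> ('a \<Rightarrow> 'a) \<Rightarrow> bool" where
  "corrects \<eta> N s \<longleftrightarrow> s \<in> emb (A N) K \<and>
     (\<forall>m\<le>N. \<forall>h \<in> emb (A m) (A N).
        \<gamma> m (compose (universe (A m)) \<eta> (compose (universe (A m)) s h)) = \<gamma> m h)"

text \<open>
  By unavoidability some \<open>\<eta> \<circ> s\<close> has the colour of the inclusion of \<open>A N\<close> in \<open>K\<close>, and by
  coherence \<open>\<eta> \<circ> s\<close> then preserves the colours of all embeddings into \<open>A N\<close>.
\<close>

lemma corrects_exists:
  assumes \<eta>: "\<eta> \<in> emb K K"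
  obtains s where "corrects \<eta> N s"
proof -
  let ?i = "restrict (\<lambda>x. x) (universe (A N))"
  have i: "?i \<in> emb (A N) K"
    by (rule emb_of_substructure[OF sub])
  obtain s where s: "s \<in> emb (A N) K" "\<gamma> N (compose (universe (A N)) \<eta> s) = \<gamma> N ?i"
    using unavoidable_coloring_attained[OF coloring i \<eta>] .
  have "\<gamma> m (compose (universe (A m)) \<eta> (compose (universe (A m)) s h)) = \<gamma> m h"
    if mN: "m \<le> N" and h: "h \<in> emb (A m) (A N)" for m h
  proof -
    have "\<gamma> m (compose (universe (A m)) (compose (universe (A N)) \<eta> s) h)
        = \<gamma> m (compose (universe (A m)) ?i h)"
      using coherent[OF mN] h i s emb_compose[OF s(1) \<eta>] unfolding coloring_ll_def by blast
    moreover have "compose (universe (A m)) ?i h = h"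
      by (rule emb_eqI[OF emb_compose[OF h i] h]) (simp add: compose_def emb_mem[OF h])
    ultimately show ?thesis
      by (simp add: emb_compose_assoc[OF h])
  qed
  with s(1) that show thesis unfolding corrects_def by blast
qed

text \<open>A level \<open>N\<close> containing both images suffices, because one \<open>s\<close>
  corrects all levels up to \<open>N\<close> at once. This is what allows colourings tied to
  different levels to be compared.\<close>

lemma corrects_exists_two:
  assumes \<eta>: "\<eta> \<in> emb K K" and "h \<in> emb (A m) K" "h' \<in> emb (A n) K"
  obtains N s where "corrects \<eta> N s" "m \<le> N" "n \<le> N" "h \<in> emb (A m) (A N)" "h' \<in> emb (A n) (A N)"
proof -
  have "finite (h ` universe (A m) \<union> h' ` universe (A n))"
    "h ` universe (A m) \<union> h' ` universe (A n) \<subseteq> universe K"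
    using emb_mem[OF assms(2)] emb_mem[OF assms(3)] by (auto simp: finite_level)
  then obtain N where N: "max m n \<le> N" "h ` universe (A m) \<union> h' ` universe (A n) \<subseteq> universe (A N)"
    by (rule exhaustion_finite_subset[OF exhaustion])
  obtain s where "corrects \<eta> N s"
    using corrects_exists[OF \<eta>] .
  with that N show thesis
    using emb_into_substructure[OF sub assms(2)] emb_into_substructure[OF sub assms(3)] by simp
qed

section \<open>Measurable colourings\<close>

text \<open>By homogeneity every member of \<open>emb B K\<close> has the form
  \<open>h \<circ> b\<close>, so the condition constrains \<chi> everywhere. One embedding may arise
  from several \<open>h\<close> of different colours.\<close>

definition measurable :: "('s, 'b) struct \<Rightarrow> nat \<Rightarrow> ('b \<Rightarrow> 'a) \<Rightarrow> (('b \<Rightarrow> 'a) \<Rightarrow> 'c) \<Rightarrow> bool" where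
  "measurable B n b \<chi> \<longleftrightarrow>
     (\<forall>h \<in> emb (A n) K. \<forall>h' \<in> emb (A n) K. \<gamma> n h = \<gamma> n h' \<longrightarrow>
        \<chi> (compose (universe B) h b) = \<chi> (compose (universe B) h' b))"

lemma measurableD:
  "measurable B n b \<chi> \<Longrightarrow> h \<in> emb (A n) K \<Longrightarrow> h' \<in> emb (A n) K \<Longrightarrow> \<gamma> n h = \<gamma> n h' \<Longrightarrow>
    \<chi> (compose (universe B) h b) = \<chi> (compose (universe B) h' b)"
  unfolding measurable_def by blast

text \<open>The embeddings \<open>\<eta> \<circ> s \<circ> h\<close> and \<open>h\<close> have the
  same \<open>\<gamma> n\<close>-colour. Thus each value of a measurable colouring recurs at a
  specified point in the range of \<eta>.\<close>

lemma measurable_corrects: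
  assumes "measurable B n b \<chi>" and b: "b \<in> emb B (A n)" and \<eta>: "\<eta> \<in> emb K K"
    and s: "corrects \<eta> N s" "n \<le> N" and h: "h \<in> emb (A n) (A N)"
  shows "\<chi> (compose (universe B) \<eta> (compose (universe B) s (compose (universe B) h b)))
    = \<chi> (compose (universe B) h b)"
proof -
  let ?k = "compose (universe (A n)) \<eta> (compose (universe (A n)) s h)"
  have sK: "s \<in> emb (A N) K" using s by (simp add: corrects_def)
  have sh: "compose (universe (A n)) s h \<in> emb (A n) K"
    by (rule emb_compose[OF h sK])
  have k: "?k \<in> emb (A n) K"
    by (rule emb_compose[OF sh \<eta>])
  have "\<gamma> n ?k = \<gamma> n h"
    using s h by (simp add: corrects_def)
  then have "\<chi> (compose (universe B) ?k b) = \<chi> (compose (universe B) h b)"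
    using measurableD[OF assms(1) k emb_out_of_substructure[OF sub h]] by simp
  then show ?thesis
    by (simp add: emb_compose_assoc[OF b])
qed

text \<open>Both colourings take the same value at \<open>f\<close> as at
  \<open>\<eta> \<circ> s \<circ> f\<close>, where they agree by assumption. The same
  \<open>s\<close> must serve the extensions of \<open>f\<close> along \<open>c\<close> and along
  \<open>b\<close>.\<close>

lemma measurable_unique:
  assumes \<chi>: "measurable B m c \<chi>" "c \<in> emb B (A m)" and \<delta>: "measurable B n b \<delta>" "b \<in> emb B (A n)"
    and \<eta>: "\<eta> \<in> emb K K"
    and eq: "\<And>g. g \<in> emb B K \<Longrightarrow> \<chi> (compose (universe B) \<eta> g) = \<delta> (compose (universe B) \<eta> g)"
    and f: "f \<in> emb B K"
  shows "\<chi> f = \<delta> f"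
proof -
  obtain h where h: "h \<in> emb (A m) K" "compose (universe B) h c = f"
    using emb_extend_level[OF \<chi>(2) f] .
  obtain h' where h': "h' \<in> emb (A n) K" "compose (universe B) h' b = f"
    using emb_extend_level[OF \<delta>(2) f] .
  obtain N s where N: "corrects \<eta> N s" "m \<le> N" "n \<le> N" "h \<in> emb (A m) (A N)" "h' \<in> emb (A n) (A N)"
    using corrects_exists_two[OF \<eta> h(1) h'(1)] .
  have "f \<in> emb B (A N)"
    using emb_compose[OF \<chi>(2) N(4)] h(2) by simp
  moreover have "s \<in> emb (A N) K"
    using N(1) by (simp add: corrects_def)
  ultimately have sf: "compose (universe B) s f \<in> emb B K"
    by (rule emb_compose)
  have "\<chi> f = \<chi> (compose (universe B) \<eta> (compose (universe B) s f))"
    using measurable_corrects[OF \<chi> \<eta> N(1,2,4)] h(2) by simp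
  also have "\<dots> = \<delta> (compose (universe B) \<eta> (compose (universe B) s f))"
    by (rule eq[OF sf])
  also have "\<dots> = \<delta> f"
    using measurable_corrects[OF \<delta> \<eta> N(1,3,5)] h'(2) by simp
  finally show ?thesis .
qed

text \<open>The value at \<open>f\<close> recurs at \<open>\<eta> \<circ> s \<circ> f\<close>. For
  the pullback colouring this gives the lower bound on the degree and the last clause of a big
  Ramsey structure.\<close>

lemma measurable_unavoidable:
  assumes \<chi>: "measurable B n b \<chi>" "b \<in> emb B (A n)" and \<eta>: "\<eta> \<in> emb K K"
  shows "(\<lambda>f. \<chi> (compose (universe B) \<eta> f)) ` emb B K = \<chi> ` emb B K"
proof (intro equalityI subsetI)
  fix v assume "v \<in> (\<lambda>f. \<chi> (compose (universe B) \<eta> f)) ` emb B K"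
  then show "v \<in> \<chi> ` emb B K" by (auto intro: emb_compose[OF _ \<eta>])
next
  fix v assume "v \<in> \<chi> ` emb B K"
  then obtain f where f: "f \<in> emb B K" "v = \<chi> f" by auto
  obtain h where h: "h \<in> emb (A n) K" "compose (universe B) h b = f"
    using emb_extend_level[OF \<chi>(2) f(1)] .
  obtain N s where N: "corrects \<eta> N s" "n \<le> N" "h \<in> emb (A n) (A N)"
    using corrects_exists_two[OF \<eta> h(1) h(1)] .
  have "f \<in> emb B (A N)"
    using emb_compose[OF \<chi>(2) N(3)] h(2) by simp
  moreover have "s \<in> emb (A N) K"
    using N(1) by (simp add: corrects_def)
  ultimately have "compose (universe B) s f \<in> emb B K"
    by (rule emb_compose)
  moreover have "\<chi> (compose (universe B) \<eta> (compose (universe B) s f)) = v"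
    using measurable_corrects[OF \<chi> \<eta> N] h(2) f(2) by simp
  ultimately show "v \<in> (\<lambda>f. \<chi> (compose (universe B) \<eta> f)) ` emb B K" by blast
qed

text \<open>Each value is computed from one chosen representative of a
  \<open>\<gamma> n\<close>-colour, and there are finitely many colours.\<close>

lemma measurable_finite_image:
  assumes \<chi>: "measurable B n b \<chi>" and b: "b \<in> emb B (A n)"
  shows "finite (\<chi> ` emb B K)"
proof (rule finite_subset)
  let ?h = "\<lambda>i. SOME h. h \<in> emb (A n) K \<and> \<gamma> n h = i"
  show "finite ((\<lambda>i. \<chi> (compose (universe B) (?h i) b)) ` \<gamma> n ` emb (A n) K)"
    using finite_unavoidable_coloring[OF coloring] by simp
  show "\<chi> ` emb B K \<subseteq> (\<lambda>i. \<chi> (compose (universe B) (?h i) b)) ` \<gamma> n ` emb (A n) K"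
  proof
    fix v assume "v \<in> \<chi> ` emb B K"
    then obtain f where f: "f \<in> emb B K" "v = \<chi> f" by auto
    obtain h where h: "h \<in> emb (A n) K" "compose (universe B) h b = f"
      using emb_extend_level[OF b f(1)] .
    have "?h (\<gamma> n h) \<in> emb (A n) K \<and> \<gamma> n (?h (\<gamma> n h)) = \<gamma> n h"
      by (rule someI[of _ h]) (simp add: h)
    then have "v = \<chi> (compose (universe B) (?h (\<gamma> n h)) b)"
      using measurableD[OF \<chi> h(1), of "?h (\<gamma> n h)"] h(2) f(2) by simp
    with h(1) show "v \<in> (\<lambda>i. \<chi> (compose (universe B) (?h i) b)) ` \<gamma> n ` emb (A n) K" by blast
  qed
qed

text \<open>The degree is applied to the pair of \<chi> and \<open>\<gamma> n\<close>. On the range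
  of a suitable \<eta> the pair has at most \<open>R n\<close> values, while
  \<open>\<gamma> n\<close> alone already has \<open>R n\<close> values there, so the second
  component determines the first.\<close>

lemma coloring_refined:
  assumes fin: "finite (\<chi> ` emb B K)" and b: "b \<in> emb B (A n)"
  obtains \<eta> where "\<eta> \<in> emb K K"
    "\<And>k k'. k \<in> emb (A n) K \<Longrightarrow> k' \<in> emb (A n) K \<Longrightarrow>
      \<gamma> n (compose (universe (A n)) \<eta> k) = \<gamma> n (compose (universe (A n)) \<eta> k') \<Longrightarrow>
      \<chi> (compose (universe B) \<eta> (compose (universe B) k b))
        = \<chi> (compose (universe B) \<eta> (compose (universe B) k' b))"
proof -
  let ?\<psi> = "\<lambda>h. (\<chi> (compose (universe B) h b), \<gamma> n h)"
  have "?\<psi> ` emb (A n) K \<subseteq> \<chi> ` emb B K \<times> \<gamma> n ` emb (A n) K"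
    using emb_compose[OF b] by auto
  then have fin\<psi>: "finite (?\<psi> ` emb (A n) K)"
    using fin finite_unavoidable_coloring[OF coloring] by (meson finite_SigmaI finite_subset)
  obtain \<eta> where \<eta>: "\<eta> \<in> emb K K"
    "card ((\<lambda>f. ?\<psi> (compose (universe (A n)) \<eta> f)) ` emb (A n) K) \<le> R n"
    using big_ramsey_degree_finite_coloring[OF degree fin\<psi>] .
  define P where "P = (\<lambda>f. ?\<psi> (compose (universe (A n)) \<eta> f)) ` emb (A n) K"
  have finP: "finite P"
    by (rule finite_subset[OF _ fin\<psi>]) (auto simp: P_def intro!: imageI emb_compose[OF _ \<eta>(1)])
  have "\<gamma> n ` emb (A n) K \<subseteq> snd ` P"
  proof
    fix v assume "v \<in> \<gamma> n ` emb (A n) K"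
    then obtain f where f: "f \<in> emb (A n) K" "v = \<gamma> n f" by auto
    obtain g where g: "g \<in> emb (A n) K" "\<gamma> n (compose (universe (A n)) \<eta> g) = \<gamma> n f"
      using unavoidable_coloring_attained[OF coloring f(1) \<eta>(1)] .
    have "v = snd (?\<psi> (compose (universe (A n)) \<eta> g))" using f g by simp
    then show "v \<in> snd ` P" unfolding P_def using g(1) by blast
  qed
  then have "card (\<gamma> n ` emb (A n) K) \<le> card (snd ` P)"
    by (intro card_mono finite_imageI finP)
  moreover have "card (\<gamma> n ` emb (A n) K) = R n"
    using coloring[of n] by (auto simp: unavoidable_coloring_def)
  \<comment> \<open>The chain from \<open>R n\<close> through the cardinalities of the projection
    and of \<open>P\<close> back to \<open>R n\<close> collapses to equalities.\<close>
  ultimately have "card (snd ` P) = card P"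
    using \<eta>(2) card_image_le[OF finP, of snd] by (simp add: P_def)
  then have inj: "inj_on snd P"
    by (rule eq_card_imp_inj_on[OF finP])
  show thesis
  proof (rule that[OF \<eta>(1)])
    fix k k'
    assume k: "k \<in> emb (A n) K" "k' \<in> emb (A n) K"
      and eq: "\<gamma> n (compose (universe (A n)) \<eta> k) = \<gamma> n (compose (universe (A n)) \<eta> k')"
    have "?\<psi> (compose (universe (A n)) \<eta> k) = ?\<psi> (compose (universe (A n)) \<eta> k')"
      by (rule inj_onD[OF inj]) (use k eq in \<open>auto simp: P_def\<close>)
    then show "\<chi> (compose (universe B) \<eta> (compose (universe B) k b))
        = \<chi> (compose (universe B) \<eta> (compose (universe B) k' b))"
      by (simp add: emb_compose_assoc[OF b])
  qed
qed

text \<open>Unavoidability gives every colour of \<open>\<gamma> n\<close> a representative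
  \<open>\<eta> \<circ> k\<close>; the value there is assigned to all \<open>h \<circ> b\<close>
  with \<open>h\<close> of that colour. The point at issue is that this is independent of the choice
  of \<open>h\<close> and \<open>k\<close>.\<close>

lemma measurable_exists:
  assumes fin: "finite (\<chi> ` emb B K)" and b: "b \<in> emb B (A n)"
  obtains \<eta> \<delta> where "\<eta> \<in> emb K K" "measurable B n b \<delta>"
    "\<And>f. f \<in> emb B K \<Longrightarrow> \<delta> (compose (universe B) \<eta> f) = \<chi> (compose (universe B) \<eta> f)"
proof -
  obtain \<eta> where \<eta>: "\<eta> \<in> emb K K"
    and refined: "\<And>k k'. k \<in> emb (A n) K \<Longrightarrow> k' \<in> emb (A n) K \<Longrightarrow>
      \<gamma> n (compose (universe (A n)) \<eta> k) = \<gamma> n (compose (universe (A n)) \<eta> k') \<Longrightarrow>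
      \<chi> (compose (universe B) \<eta> (compose (universe B) k b))
        = \<chi> (compose (universe B) \<eta> (compose (universe B) k' b))"
    using coloring_refined[OF fin b] by blast
  define rel where "rel f v \<longleftrightarrow> (\<exists>h \<in> emb (A n) K. \<exists>k \<in> emb (A n) K.
      compose (universe B) h b = f \<and> \<gamma> n (compose (universe (A n)) \<eta> k) = \<gamma> n h \<and>
      v = \<chi> (compose (universe B) \<eta> (compose (universe B) k b)))" for f v
  have unique: "v = v'" if "rel f v" "rel f v'" for f v v'
  proof -
    obtain h k where hk: "h \<in> emb (A n) K" "k \<in> emb (A n) K" "compose (universe B) h b = f"
      "\<gamma> n (compose (universe (A n)) \<eta> k) = \<gamma> n h"
      "v = \<chi> (compose (universe B) \<eta> (compose (universe B) k b))"
      using \<open>rel f v\<close> by (auto simp: rel_def)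
    obtain h' k' where hk': "h' \<in> emb (A n) K" "k' \<in> emb (A n) K" "compose (universe B) h' b = f"
      "\<gamma> n (compose (universe (A n)) \<eta> k') = \<gamma> n h'"
      "v' = \<chi> (compose (universe B) \<eta> (compose (universe B) k' b))"
      using \<open>rel f v'\<close> by (auto simp: rel_def)
    obtain N s where N: "corrects \<eta> N s" "n \<le> N" "h \<in> emb (A n) (A N)" "h' \<in> emb (A n) (A N)"
      using corrects_exists_two[OF \<eta> hk(1) hk'(1)] .
    have s: "s \<in> emb (A N) K" using N(1) by (simp add: corrects_def)
    \<comment> \<open>Since \<open>\<eta> \<circ> s \<circ> g\<close> has the colour of
      \<open>g\<close>, hence of \<open>\<eta> \<circ> j\<close>, refinement applies to
      \<open>j\<close> and \<open>s \<circ> g\<close>. The right-hand side depends only on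
      \<open>g \<circ> b\<close>, which is \<open>f\<close> for both candidates.\<close>
    have *: "\<chi> (compose (universe B) \<eta> (compose (universe B) j b))
        = \<chi> (compose (universe B) \<eta> (compose (universe B) s (compose (universe B) g b)))"
      if "j \<in> emb (A n) K" "g \<in> emb (A n) (A N)" "\<gamma> n (compose (universe (A n)) \<eta> j) = \<gamma> n g"
      for j g
      using refined[OF that(1) emb_compose[OF that(2) s]] that N(1,2)
      by (simp add: corrects_def emb_compose_assoc[OF b])
    show ?thesis
      using *[OF hk(2) N(3) hk(4)] *[OF hk'(2) N(4) hk'(4)] hk(3,5) hk'(3,5) by simp
  qed
  define \<delta> where "\<delta> f = (THE v. rel f v)" for f
  have \<delta>: "\<delta> f = v" if "rel f v" for f v
    unfolding \<delta>_def using that unique by blast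
  show thesis
  proof
    show "measurable B n b \<delta>"
      unfolding measurable_def
    proof (intro ballI impI)
      fix h h' assume h: "h \<in> emb (A n) K" "h' \<in> emb (A n) K" "\<gamma> n h = \<gamma> n h'"
      obtain k where k: "k \<in> emb (A n) K" "\<gamma> n (compose (universe (A n)) \<eta> k) = \<gamma> n h"
        using unavoidable_coloring_attained[OF coloring h(1) \<eta>] .
      let ?v = "\<chi> (compose (universe B) \<eta> (compose (universe B) k b))"
      have "rel (compose (universe B) j b) ?v" if "j \<in> emb (A n) K" "\<gamma> n j = \<gamma> n h" for j
        unfolding rel_def
        by (rule bexI[OF _ that(1)], rule bexI[OF _ k(1)]) (simp add: k(2) that(2))
      then have "rel (compose (universe B) h b) ?v" "rel (compose (universe B) h' b) ?v"
        using h by metis+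
      then show "\<delta> (compose (universe B) h b) = \<delta> (compose (universe B) h' b)"
        by (simp add: \<delta>)
    qed
    fix f assume f: "f \<in> emb B K"
    obtain k where k: "k \<in> emb (A n) K" "compose (universe B) k b = f"
      using emb_extend_level[OF b f] .
    \<comment> \<open>The witnesses are \<open>\<eta> \<circ> k\<close> in the role of
      \<open>h\<close>, and \<open>k\<close> itself.\<close>
    have "rel (compose (universe B) \<eta> f) (\<chi> (compose (universe B) \<eta> f))"
      unfolding rel_def
      by (rule bexI[OF _ emb_compose[OF k(1) \<eta>]], rule bexI[OF _ k(1)])
        (use k(2) in \<open>simp add: emb_compose_assoc[OF b]\<close>)
    then show "\<delta> (compose (universe B) \<eta> f) = \<chi> (compose (universe B) \<eta> f)"
      by (rule \<delta>)
  qed (fact \<eta>)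
qed

text \<open>Having finitely many values, \<chi> agrees on the range of some \<eta> with a colouring
  measurable for \<open>n\<close> and \<open>b\<close>; uniqueness makes the two equal
  throughout.\<close>

lemma measurable_change_level:
  assumes \<chi>: "measurable B m c \<chi>" "c \<in> emb B (A m)" and b: "b \<in> emb B (A n)"
  shows "measurable B n b \<chi>"
proof -
  obtain \<eta> \<delta> where \<eta>: "\<eta> \<in> emb K K" and \<delta>: "measurable B n b \<delta>"
    and eq: "\<And>f. f \<in> emb B K \<Longrightarrow> \<delta> (compose (universe B) \<eta> f) = \<chi> (compose (universe B) \<eta> f)"
    using measurable_exists[OF measurable_finite_image[OF \<chi>] b] by blast
  have *: "\<chi> f = \<delta> f" if "f \<in> emb B K" for f
    by (rule measurable_unique[OF \<chi> \<delta> b \<eta> _ that]) (simp add: eq)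
  show ?thesis
    unfolding measurable_def
  proof (intro ballI impI)
    fix h h' assume h: "h \<in> emb (A n) K" "h' \<in> emb (A n) K" "\<gamma> n h = \<gamma> n h'"
    show "\<chi> (compose (universe B) h b) = \<chi> (compose (universe B) h' b)"
      unfolding *[OF emb_compose[OF b h(1)]] *[OF emb_compose[OF b h(2)]]
      by (rule measurableD[OF \<delta> h])
  qed
qed

section \<open>Components of the adjacency graph on tuples\<close>

definition step :: "'a list \<Rightarrow> 'a list \<Rightarrow> bool" where
  "step xs ys \<longleftrightarrow> (\<exists>n zs. \<exists>h \<in> emb (A n) K. \<exists>h' \<in> emb (A n) K. \<gamma> n h = \<gamma> n h' \<and>
     set zs \<subseteq> universe (A n) \<and> xs = map h zs \<and> ys = map h' zs)"

lemma stepI: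
  "h \<in> emb (A n) K \<Longrightarrow> h' \<in> emb (A n) K \<Longrightarrow> \<gamma> n h = \<gamma> n h' \<Longrightarrow> set zs \<subseteq> universe (A n) \<Longrightarrow>
    step (map h zs) (map h' zs)"
  unfolding step_def by blast

lemma step_sym: "step xs ys \<Longrightarrow> step ys xs"
  unfolding step_def by metis

lemma steps_sym: "step\<^sup>*\<^sup>* xs ys \<Longrightarrow> step\<^sup>*\<^sup>* ys xs"
  by (induction rule: rtranclp_induct) (auto intro: step_sym converse_rtranclp_into_rtranclp)

lemma steps_tuple:
  "step\<^sup>*\<^sup>* xs ys \<Longrightarrow> xs \<in> lists (universe K) \<Longrightarrow> length ys = length xs \<and> ys \<in> lists (universe K)"
  by (induction rule: rtranclp_induct) (auto simp: step_def subset_iff emb_mem)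

text \<open>A component is named by the number of a chosen member. Countability of \<open>K\<close>
  thus makes natural numbers sufficient as new symbols.\<close>

definition code :: "'a list \<Rightarrow> nat" where
  "code xs = to_nat_on (lists (universe K)) (SOME ys. step\<^sup>*\<^sup>* xs ys)"

lemma countable_tuples: "countable (lists (universe K))"
  using fraisse by (auto simp: fraisse_def)

lemma steps_some: "step\<^sup>*\<^sup>* xs (SOME ys. step\<^sup>*\<^sup>* xs ys)"
  by (rule someI[of _ xs]) simp

lemma code_eq_iff:
  assumes "xs \<in> lists (universe K)" "ys \<in> lists (universe K)"
  shows "code xs = code ys \<longleftrightarrow> step\<^sup>*\<^sup>* xs ys"
proof
  let ?r = "\<lambda>xs. SOME ys. step\<^sup>*\<^sup>* xs ys"
  assume "code xs = code ys"
  then have "?r xs = ?r ys"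
    unfolding code_def
    using to_nat_on_inj[OF countable_tuples] steps_tuple[OF steps_some] assms by metis
  then show "step\<^sup>*\<^sup>* xs ys"
    using steps_some[of xs] steps_sym[OF steps_some[of ys]] by simp
next
  assume "step\<^sup>*\<^sup>* xs ys"
  \<comment> \<open>Connected tuples define the same predicate, so \<open>SOME\<close> picks the
    same representative for both.\<close>
  then have "step\<^sup>*\<^sup>* xs = step\<^sup>*\<^sup>* ys"
    by (auto simp: fun_eq_iff intro: steps_sym rtranclp_trans)
  then show "code xs = code ys"
    by (simp add: code_def)
qed

section \<open>The expansion and its age\<close>

text \<open>Adjacent tuples have equal length, so the arity can be read off the representative
  numbered \<open>j\<close>. A \<open>j\<close> that is no code names an empty relation.\<close>

definition expanded_language :: "('s + nat) language" where
  "expanded_language = case_sum L (\<lambda>j. Some (length (from_nat_into (lists (universe K)) j)))"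

definition expanded :: "('s + nat, 'a) struct" where
  "expanded = \<lparr>universe = universe K,
     interp = case_sum (interp K) (\<lambda>j. {xs \<in> lists (universe K). code xs = j})\<rparr>"

lemma structure_K: "is_structure L K"
  using fraisse by (simp add: fraisse_def)

lemma structure_expanded: "is_structure expanded_language expanded"
  unfolding is_structure_def
proof (intro allI ballI)
  fix t xs assume xs: "xs \<in> interp expanded t"
  show "set xs \<subseteq> universe expanded \<and> expanded_language t = Some (length xs)"
  proof (cases t)
    case (Inl s)
    then show ?thesis
      using xs structure_K by (auto simp: expanded_def expanded_language_def is_structure_def)
  next
    case (Inr j)
    then have j: "xs \<in> lists (universe K)" "j = code xs"
      using xs by (auto simp: expanded_def)
    have "length (SOME ys. step\<^sup>*\<^sup>* xs ys) = length xs"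
      "(SOME ys. step\<^sup>*\<^sup>* xs ys) \<in> lists (universe K)"
      using steps_tuple[OF steps_some j(1)] by auto
    then show ?thesis
      using j Inr countable_tuples
      by (auto simp: expanded_def expanded_language_def code_def)
  qed
qed

lemma reduct_expanded: "reduct L expanded = K"
  using structure_K
  by (intro struct.equality)
    (auto simp: reduct_def expanded_def is_structure_def dom_def fun_eq_iff)

text \<open>An expansion in the age is the pullback along any embedding witnessing its membership.
  Counting expansions becomes counting the values of a colouring of \<open>emb B K\<close>.\<close>

lemma expansions_eq:
  assumes B: "is_structure L B" "finite (universe B)"
  shows "expansions L expanded_language expanded B = pullback expanded (universe B) ` emb B K"
proof (intro equalityI subsetI)
  fix C assume "C \<in> expansions L expanded_language expanded B"
  then obtain f where C: "is_structure expanded_language C" "f \<in> emb C expanded" "reduct L C = B"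
    by (auto simp: expansions_def age_def)
  have U: "universe C = universe B"
    using C(3) by (auto simp: reduct_def)
  have f: "f \<in> universe C \<rightarrow>\<^sub>E universe expanded" "inj_on f (universe C)"
    using C(2) by (auto simp: emb_def)
  have "f \<in> emb B K"
  proof (rule embI)
    show "f \<in> universe B \<rightarrow>\<^sub>E universe K" "inj_on f (universe B)"
      using f U by (simp_all add: expanded_def)
    fix s xs assume xs: "set xs \<subseteq> universe B"
    have "xs \<in> interp B s \<longleftrightarrow> s \<in> dom L \<and> xs \<in> interp C (Inl s)"
      unfolding C(3)[symmetric] by (simp add: reduct_def)
    also have "\<dots> \<longleftrightarrow> s \<in> dom L \<and> map f xs \<in> interp K s"
      using emb_interp[OF C(2), of xs "Inl s"] xs U by (simp add: expanded_def)
    \<comment> \<open>Symbols outside \<open>L\<close> are empty in \<open>K\<close>, so membership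
      of \<open>s\<close> in the domain is automatic.\<close>
    also have "\<dots> \<longleftrightarrow> map f xs \<in> interp K s"
      using structure_K unfolding is_structure_def by (metis domI)
    finally show "xs \<in> interp B s \<longleftrightarrow> map f xs \<in> interp K s" .
  qed
  moreover have "C = pullback expanded (universe B) f"
    using pullback_unique[OF structure_expanded f, of C] C U by simp
  ultimately show "C \<in> pullback expanded (universe B) ` emb B K" by blast
next
  fix C assume "C \<in> pullback expanded (universe B) ` emb B K"
  then obtain f where f: "f \<in> emb B K" and C: "C = pullback expanded (universe B) f" by auto
  have fB: "f \<in> universe B \<rightarrow>\<^sub>E universe expanded" "inj_on f (universe B)"
    using f by (auto simp: emb_def expanded_def)
  have *: "is_structure expanded_language C" "universe C = universe B" "f \<in> emb C expanded"
    using pullback_unique[OF structure_expanded fB, of C] C by auto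
  have "xs \<in> interp (reduct L C) s \<longleftrightarrow> xs \<in> interp B s" for xs s
  proof (cases "set xs \<subseteq> universe B \<and> s \<in> dom L")
    case True
    then show ?thesis
      using emb_interp[OF f, of xs s] C by (simp add: reduct_def pullback_def expanded_def)
  next
    case False
    then show ?thesis
      using B(1) C by (auto simp: reduct_def pullback_def is_structure_def)
  qed
  then have "reduct L C = B"
    using *(2) by (intro struct.equality) (auto simp: reduct_def)
  with * B(2) show "C \<in> expansions L expanded_language expanded B"
    by (auto simp: expansions_def age_def)
qed

section \<open>Measurable colourings and the expansion\<close>

text \<open>The symbols of \<open>L\<close> cannot distinguish two embeddings of \<open>B\<close>,
  and the new ones cannot distinguish the adjacent images of \<open>map b xs\<close> under
  \<open>h\<close> and \<open>h'\<close>.\<close>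

lemma measurable_pullback:
  assumes b: "b \<in> emb B (A n)"
  shows "measurable B n b (pullback expanded (universe B))"
  unfolding measurable_def
proof (intro ballI impI)
  fix h h' assume h: "h \<in> emb (A n) K" "h' \<in> emb (A n) K" "\<gamma> n h = \<gamma> n h'"
  have inl: "map (compose (universe B) h b) xs \<in> interp K s
      \<longleftrightarrow> map (compose (universe B) h' b) xs \<in> interp K s" if "set xs \<subseteq> universe B" for xs s
    using emb_interp[OF emb_compose[OF b h(1)] that] emb_interp[OF emb_compose[OF b h(2)] that]
    by simp
  have inr: "code (map (compose (universe B) h b) xs) = code (map (compose (universe B) h' b) xs)"
    "map (compose (universe B) h b) xs \<in> lists (universe K)"
    "map (compose (universe B) h' b) xs \<in> lists (universe K)" if xs: "set xs \<subseteq> universe B" for xs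
  proof -
    show l: "map (compose (universe B) h b) xs \<in> lists (universe K)"
      "map (compose (universe B) h' b) xs \<in> lists (universe K)"
      using emb_map_lists[OF emb_compose[OF b _] xs] h(1,2) by blast+
    have "map (compose (universe B) g b) xs = map g (map b xs)" for g :: "'a \<Rightarrow> 'a"
      using xs by (auto simp: compose_def)
    moreover have "set (map b xs) \<subseteq> universe (A n)"
      using xs emb_mem[OF b] by auto
    ultimately have "step (map (compose (universe B) h b) xs) (map (compose (universe B) h' b) xs)"
      using stepI[OF h] by (simp only:)
    then show "code (map (compose (universe B) h b) xs) = code (map (compose (universe B) h' b) xs)"
      using code_eq_iff[OF l] by blast
  qed
  have "map (compose (universe B) h b) xs \<in> interp expanded t
      \<longleftrightarrow> map (compose (universe B) h' b) xs \<in> interp expanded t" if "set xs \<subseteq> universe B" for xs t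
    using inl[OF that] inr[OF that] by (cases t) (simp_all only: expanded_def, auto)
  then show "pullback expanded (universe B) (compose (universe B) h b)
      = pullback expanded (universe B) (compose (universe B) h' b)"
    unfolding pullback_def by auto
qed

text \<open>Equal pullbacks put the images of an enumeration of \<open>B\<close> into one component.
  Along a path between them every tuple is the image of that enumeration under an embedding with the
  same \<chi>-value.\<close>

lemma measurable_factors:
  assumes \<chi>: "measurable B m c \<chi>" "c \<in> emb B (A m)"
    and f: "f \<in> emb B K" and g: "g \<in> emb B K"
    and eq: "pullback expanded (universe B) f = pullback expanded (universe B) g"
  shows "\<chi> f = \<chi> g"
proof -
  obtain as where as: "set as = universe B"
    using finite_list[OF emb_level_finite[OF \<chi>(2)]] by blast
  have l: "map f as \<in> lists (universe K)" "map g as \<in> lists (universe K)"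
    using emb_map_lists[OF f] emb_map_lists[OF g] as by blast+
  have "interp (pullback expanded (universe B) f) (Inr (code (map f as)))
      = interp (pullback expanded (universe B) g) (Inr (code (map f as)))"
    by (simp add: eq)
  moreover have "as \<in> interp (pullback expanded (universe B) f) (Inr (code (map f as)))"
    using l as by (simp add: pullback_def expanded_def)
  ultimately have "code (map f as) = code (map g as)"
    by (simp add: pullback_def expanded_def)
  then have "step\<^sup>*\<^sup>* (map f as) (map g as)"
    by (simp only: code_eq_iff[OF l])
  then have "\<exists>u \<in> emb B K. map g as = map u as \<and> \<chi> u = \<chi> f"
  proof (induction rule: rtranclp_induct)
    case base
    then show ?case using f by blast
  next
    case (step ys zs)
    then obtain u where u: "u \<in> emb B K" "ys = map u as" "\<chi> u = \<chi> f" by blast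
    from step.hyps(2) obtain n ws h h' where h: "h \<in> emb (A n) K" "h' \<in> emb (A n) K"
      "\<gamma> n h = \<gamma> n h'" "set ws \<subseteq> universe (A n)" "ys = map h ws" "zs = map h' ws"
      unfolding step_def by blast
    \<comment> \<open>The tuple \<open>ws\<close> need not enumerate \<open>A n\<close>, but its
      image is that of \<open>u\<close>. Hence \<open>u\<close> factors through \<open>h\<close> as
      \<open>h \<circ> b\<close>, and injectivity of \<open>h\<close> identifies \<open>ws\<close>
      with \<open>map b as\<close>.\<close>
    have "u ` universe B = h ` set ws"
      using u(2) h(5) as by (metis list.set_map)
    with h(4) have "u ` universe B \<subseteq> h ` universe (A n)" by blast
    then obtain b where b: "b \<in> emb B (A n)" "compose (universe B) h b = u"
      using emb_factor[OF u(1) h(1)] by blast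
    have "map h ws = map h (map b as)"
      using u(2) h(5) b(2) as by (auto simp: compose_def)
    moreover have "inj_on h (set ws \<union> set (map b as))"
      by (rule inj_on_subset[OF emb_inj[OF h(1)]]) (use h(4) as emb_mem[OF b(1)] in auto)
    ultimately have ws: "ws = map b as"
      by (simp only: inj_on_map_eq_map)
    have "zs = map (compose (universe B) h' b) as"
      using h(6) ws as by (simp add: compose_def)
    \<comment> \<open>Each step of the path brings its own \<open>n\<close> and \<open>b\<close>, so
      measurability has to be moved there from \<open>m\<close> and \<open>c\<close>.\<close>
    moreover have "\<chi> (compose (universe B) h' b) = \<chi> f"
      using measurableD[OF measurable_change_level[OF \<chi> b(1)] h(1-3)] b(2) u(3) by simp
    ultimately show ?case
      using emb_compose[OF b(1) h(2)] by blast
  qed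
  then obtain u where u: "u \<in> emb B K" "map g as = map u as" "\<chi> u = \<chi> f" by blast
  have "g = u"
    by (rule emb_eqI[OF g u(1)]) (use u(2) as in auto)
  with u(3) show ?thesis by simp
qed

text \<open>For the upper bound, a finite colouring agrees on some \<eta> with a measurable one,
  which factors through the pullback. For the lower bound, the pullback is itself a colouring that
  keeps all its values under every \<eta>.\<close>

lemma degree_pullback:
  assumes b: "b \<in> emb B (A n)"
  shows "has_big_ramsey_degree K B (card (pullback expanded (universe B) ` emb B K))"
proof -
  let ?D = "pullback expanded (universe B)"
  have D: "measurable B n b ?D"
    by (rule measurable_pullback[OF b])
  have fin: "finite (?D ` emb B K)"
    by (rule measurable_finite_image[OF D b])
  show ?thesis
    unfolding has_big_ramsey_degree_def
  proof (intro conjI allI impI)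
    fix r
    show "big_ramsey_arrow K B r (card (?D ` emb B K))"
      unfolding big_ramsey_arrow_def
    proof
      fix \<chi> assume "\<chi> \<in> emb B K \<rightarrow> {..<r}"
      then have "finite (\<chi> ` emb B K)"
        using finite_subset[of "\<chi> ` emb B K" "{..<r}"] by (simp add: funcset_image)
      then obtain \<eta> \<delta> where \<eta>: "\<eta> \<in> emb K K" and \<delta>: "measurable B n b \<delta>"
        and eq: "\<And>f. f \<in> emb B K \<Longrightarrow> \<delta> (compose (universe B) \<eta> f) = \<chi> (compose (universe B) \<eta> f)"
        using measurable_exists[OF _ b] by blast
      have "(\<lambda>f. \<chi> (compose (universe B) \<eta> f)) ` emb B K \<subseteq> \<delta> ` emb B K"
        by (auto simp flip: eq intro!: imageI emb_compose[OF _ \<eta>])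
      \<comment> \<open>The factorisation is made explicit by a chosen preimage of each
        pullback.\<close>
      moreover have "\<delta> ` emb B K = (\<lambda>d. \<delta> (inv_into (emb B K) ?D d)) ` ?D ` emb B K"
        unfolding image_image
      proof (rule image_cong[OF refl])
        fix f assume f: "f \<in> emb B K"
        then have "?D f \<in> ?D ` emb B K" by simp
        then show "\<delta> f = \<delta> (inv_into (emb B K) ?D (?D f))"
          by (intro measurable_factors[OF \<delta> b f]) (simp_all add: inv_into_into f_inv_into_f)
      qed
      ultimately have "card ((\<lambda>f. \<chi> (compose (universe B) \<eta> f)) ` emb B K) \<le> card (?D ` emb B K)"
        by (intro surj_card_le[OF fin]) simp
      with \<eta> show "\<exists>\<eta> \<in> emb K K. card ((\<lambda>f. \<chi> (compose (universe B) \<eta> f)) ` emb B K)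
          \<le> card (?D ` emb B K)" by blast
    qed
  next
    fix l assume l: "\<forall>r>l. big_ramsey_arrow K B r l"
    show "card (?D ` emb B K) \<le> l"
    proof (cases "card (?D ` emb B K) > l")
      case True
      obtain e where e: "bij_betw e (?D ` emb B K) {0..<card (?D ` emb B K)}"
        using ex_bij_betw_finite_nat[OF fin] by blast
      have e_col: "(\<lambda>f. e (?D f)) \<in> emb B K \<rightarrow> {..<card (?D ` emb B K)}"
        using bij_betwE[OF e] by auto
      have "big_ramsey_arrow K B (card (?D ` emb B K)) l"
        using l True by blast
      from this[unfolded big_ramsey_arrow_def, THEN bspec, OF e_col]
      obtain \<eta> where \<eta>: "\<eta> \<in> emb K K"
        "card ((\<lambda>f. e (?D (compose (universe B) \<eta> f))) ` emb B K) \<le> l" ..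
      have "(\<lambda>f. e (?D (compose (universe B) \<eta> f))) ` emb B K = e ` ?D ` emb B K"
        unfolding measurable_unavoidable[OF D b \<eta>(1), symmetric] image_image ..
      then show ?thesis
        using \<eta>(2) card_image[OF bij_betw_imp_inj_on[OF e]] by simp
    qed simp
  qed
qed

lemma big_ramsey_structure_expanded:
  "big_ramsey_structure L K expanded_language expanded"
  unfolding big_ramsey_structure_def
proof (intro conjI ballI)
  show "sublanguage L expanded_language"
    by (simp add: sublanguage_def expanded_language_def)
  fix B assume "B \<in> age L K"
  then obtain f where B: "is_structure L B" "finite (universe B)" and f: "f \<in> emb B K"
    by (auto simp: age_def)
  \<comment> \<open>Although \<open>B\<close> need not be isomorphic to a level, its finite image
    lies in one, which supplies the base embedding for measurability.\<close>
  obtain n where b: "f \<in> emb B (A n)"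
    using emb_factor_level[OF f B(2)] .
  note D = measurable_pullback[OF b]
  show "finite (expansions L expanded_language expanded B)"
    using measurable_finite_image[OF D b] by (simp add: expansions_eq[OF B])
  show "has_big_ramsey_degree K B (card (expansions L expanded_language expanded B))"
    using degree_pullback[OF b] by (simp add: expansions_eq[OF B])
  fix \<eta> assume "\<eta> \<in> emb K K"
  then show "(\<lambda>f. pullback expanded (universe B) (compose (universe B) \<eta> f)) ` emb B K
      = expansions L expanded_language expanded B"
    using measurable_unavoidable[OF D b] by (simp add: expansions_eq[OF B])
qed (fact structure_expanded reduct_expanded)+

end

theorem theorem7p1:
  fixes L :: "'s language"
    and K :: "('s, 'a) struct"
    and A :: "nat \<Rightarrow> ('s, 'a) struct"
    and R :: "nat \<Rightarrow> nat"
    and \<gamma> :: "nat \<Rightarrow> ('a \<Rightarrow> 'a) \<Rightarrow> nat"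
  assumes "fraisse L K"
    and "exhaustion K A"
    and "\<And>m. has_big_ramsey_degree K (A m) (R m)"
    and "\<And>m. unavoidable_coloring K (A m) (R m) (\<gamma> m)"
    and "\<And>m n. m \<le> n \<Longrightarrow> coloring_ll K (A m) (A n) (\<gamma> m) (\<gamma> n)"
  shows "\<exists>(L' :: ('s + nat) language) K'. big_ramsey_structure L K L' K'"
proof -
  interpret coherent_colorings L K A R \<gamma>
    by unfold_locales (use assms in auto)
  show ?thesis
    using big_ramsey_structure_expanded by blast
qed

end
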